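(* Let $C$ be a cyclically ordered graph with at least one edge. Then either $sat_{\circlearrowright}(n,C)=O(1)$ or $sat_{\circlearrowright}(n,C)=\Theta(n)$ (as $n\to\infty$).
   Context: A cyclically ordered graph is a finite simple graph whose vertex set is cyclically ordered. A cyclically ordered graph $H$ contains a cyclically ordered graph $C$ if there is an injective map $\varphi:V(C)\to V(H)$ preserving the cyclic order with $\varphi(u)\varphi(v)\in E(H)$ for all $uv\in E(C)$; otherwise $H$ avoids $C$. $H$ saturates $C$ if $H$ avoids $C$ but for every pair of distinct non-adjacent vertices $x,y$ of $H$ the graph $H+xy$ contains $C$. $sat_{\circlearrowright}(n,C)$ is the minimum number of edges of a cyclically ordered graph on $n$ vertices saturating $C$. *)

theory Defs
  imports Main "HOL-Library.Landau_Symbols"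
begin

definition cyclic_order_on :: "'a set \<Rightarrow> ('a \<Rightarrow> 'a \<Rightarrow> 'a \<Rightarrow> bool) \<Rightarrow> bool" where
  "cyclic_order_on V R \<longleftrightarrow>
     (\<forall>a\<in>V. \<forall>b\<in>V. \<forall>c\<in>V. R a b c \<longrightarrow> R b c a) \<and>
     (\<forall>a\<in>V. \<forall>b\<in>V. \<forall>c\<in>V. R a b c \<longrightarrow> \<not> R c b a) \<and>
     (\<forall>a\<in>V. \<forall>b\<in>V. \<forall>c\<in>V. \<forall>d\<in>V. R a b c \<longrightarrow> R a c d \<longrightarrow> R a b d) \<and>
     (\<forall>a\<in>V. \<forall>b\<in>V. \<forall>c\<in>V. a \<noteq> b \<longrightarrow> b \<noteq> c \<longrightarrow> a \<noteq> c \<longrightarrow> R a b c \<or> R c b a)"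

(* "cyc H a b c" says that a, b, c are pairwise distinct and met in this order when going once
   around the circle. Its values outside "verts H" are irrelevant. *)
record 'a cyc_graph =
  verts :: "'a set"
  cyc :: "'a \<Rightarrow> 'a \<Rightarrow> 'a \<Rightarrow> bool"
  edges :: "'a set set"

definition cyclically_ordered_graph :: "'a cyc_graph \<Rightarrow> bool" where
  "cyclically_ordered_graph H \<longleftrightarrow>
     finite (verts H) \<and> cyclic_order_on (verts H) (cyc H) \<and>
     (\<forall>e\<in>edges H. \<exists>u\<in>verts H. \<exists>v\<in>verts H. u \<noteq> v \<and> e = {u, v})"

definition contains :: "'a cyc_graph \<Rightarrow> 'b cyc_graph \<Rightarrow> bool" where
  "contains H C \<longleftrightarrow>
     (\<exists>\<phi>. \<phi> ` verts C \<subseteq> verts H \<and> inj_on \<phi> (verts C) \<and>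
        (\<forall>a\<in>verts C. \<forall>b\<in>verts C. \<forall>c\<in>verts C. cyc C a b c \<longrightarrow> cyc H (\<phi> a) (\<phi> b) (\<phi> c)) \<and>
        (\<forall>u v. {u, v} \<in> edges C \<longrightarrow> {\<phi> u, \<phi> v} \<in> edges H))"

abbreviation avoids :: "'a cyc_graph \<Rightarrow> 'b cyc_graph \<Rightarrow> bool" where
  "avoids H C \<equiv> \<not> contains H C"

definition add_edge :: "'a cyc_graph \<Rightarrow> 'a \<Rightarrow> 'a \<Rightarrow> 'a cyc_graph" where
  "add_edge H x y = H\<lparr>edges := insert {x, y} (edges H)\<rparr>"

definition saturates :: "'a cyc_graph \<Rightarrow> 'b cyc_graph \<Rightarrow> bool" where
  "saturates H C \<longleftrightarrow>
     avoids H C \<and>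
     (\<forall>x\<in>verts H. \<forall>y\<in>verts H. x \<noteq> y \<longrightarrow> {x, y} \<notin> edges H \<longrightarrow> contains (add_edge H x y) C)"

(* Every finite cyclically ordered graph is isomorphic to one with vertices in nat, so letting
   H range over nat graphs loses nothing. If C has an edge, an edge-maximal C-avoiding graph on
   n vertices exists (the empty graph avoids C), so the minimum is over a nonempty set. *)
definition cyc_sat :: "nat \<Rightarrow> 'b cyc_graph \<Rightarrow> nat" where
  "cyc_sat n C =
     (LEAST m. \<exists>H :: nat cyc_graph. cyclically_ordered_graph H \<and> card (verts H) = n \<and>
        saturates H C \<and> card (edges H) = m)"

end

theory Submission
  imports Defs
begin

text \<open>
  Linear upper bound: join the first \<open>s\<close> vertices to everything, where \<open>s\<close> is one less than the
  length of a shortest arc of \<open>C\<close> that is a vertex cover. This avoids \<open>C\<close>. Deleting all but the last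
  vertex of such an arc leaves a star of \<open>C\<close> centred at its first remaining vertex, so in an edge-maximal
  \<open>C\<close>-avoiding extension every later vertex has boundedly many neighbours to its right.

  Dichotomy: let \<open>k\<close> be the number of vertices of \<open>C\<close>. If some saturating graph has \<open>k\<close> consecutive
  isolated vertices, then a further isolated vertex can be inserted there without destroying
  saturation, so the saturation number is bounded. Otherwise each arc of \<open>k\<close> vertices of a
  saturating graph meets an edge, which forces linearly many edges.
\<close>

section \<open>Cyclic orders on the naturals and a normal form for graphs\<close>

definition ccw :: "nat \<Rightarrow> nat \<Rightarrow> nat \<Rightarrow> bool" where
  "ccw a b c \<longleftrightarrow> a < b \<and> b < c \<or> b < c \<and> c < a \<or> c < a \<and> a < b"

text \<open>The normal form: saturating graphs are relabelled to this shape, after which only the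
  edge set varies.\<close>

definition circ_graph :: "nat \<Rightarrow> nat set set \<Rightarrow> nat cyc_graph" where
  "circ_graph n E = \<lparr>verts = {..<n}, cyc = ccw, edges = E\<rparr>"

text \<open>The edge set of the complete graph on \<open>V\<close>.\<close>

definition pairs :: "'a set \<Rightarrow> 'a set set" where
  "pairs V = {{u, v} |u v. u \<in> V \<and> v \<in> V \<and> u \<noteq> v}"

lemma circ_graph_simps [simp]:
  "verts (circ_graph n E) = {..<n}" "cyc (circ_graph n E) = ccw" "edges (circ_graph n E) = E"
  by (simp_all add: circ_graph_def)

lemma add_edge_simps [simp]:
  "verts (add_edge H x y) = verts H" "cyc (add_edge H x y) = cyc H"
  "edges (add_edge H x y) = insert {x, y} (edges H)"
  by (simp_all add: add_edge_def)

lemma add_edge_circ_graph [simp]: "add_edge (circ_graph n E) x y = circ_graph n (insert {x, y} E)"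
  by (simp add: circ_graph_def add_edge_def)

lemma pairs_iff [simp]: "{u, v} \<in> pairs V \<longleftrightarrow> u \<in> V \<and> v \<in> V \<and> u \<noteq> v"
  unfolding pairs_def by (auto simp: doubleton_eq_iff)

lemma pairsE:
  assumes "e \<in> pairs V"
  obtains u v where "e = {u, v}" "u \<in> V" "v \<in> V" "u \<noteq> v"
  using assms unfolding pairs_def by blast

lemma pairs_nat_ordE:
  fixes e :: "nat set"
  assumes "e \<in> pairs V"
  obtains u v where "e = {u, v}" "u \<in> V" "v \<in> V" "u < v"
  using assms by (metis insert_commute linorder_neqE_nat pairsE)

lemma finite_pairs: "finite V \<Longrightarrow> finite (pairs V)"
  by (rule finite_subset[of _ "Pow V"]) (auto elim: pairsE)

lemma cyclically_ordered_graph_iff: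
  "cyclically_ordered_graph H \<longleftrightarrow>
     finite (verts H) \<and> cyclic_order_on (verts H) (cyc H) \<and> edges H \<subseteq> pairs (verts H)"
  unfolding cyclically_ordered_graph_def pairs_def by blast

lemma cyclic_order_on_ccw: "cyclic_order_on V ccw"
  unfolding cyclic_order_on_def ccw_def by auto

text \<open>Since \<open>ccw\<close> does not mention the number of vertices, this serves increasing
  maps between graphs of different sizes.\<close>

lemma ccw_mono:
  assumes "strict_mono_on S g" "a \<in> S" "b \<in> S" "c \<in> S" "ccw a b c"
  shows "ccw (g a) (g b) (g c)"
  using assms unfolding ccw_def by (meson strict_mono_onD)

text \<open>Cutting the circle at a vertex \<open>v\<close> turns the cyclic order into a linear
  one; the number of predecessors is then the wanted position.\<close>

lemma cyclic_order_rank: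
  fixes V :: "'a set" and R
  assumes "finite V" and R: "cyclic_order_on V R"
  obtains f :: "'a \<Rightarrow> nat" where "bij_betw f V {..<card V}"
    "\<And>a b c. a \<in> V \<Longrightarrow> b \<in> V \<Longrightarrow> c \<in> V \<Longrightarrow> R a b c \<longleftrightarrow> ccw (f a) (f b) (f c)"
proof (cases "V = {}")
  case True
  then show ?thesis using that[of "\<lambda>_. 0"] by (simp add: bij_betw_def)
next
  case False
  then obtain v where v: "v \<in> V" by blast
  have rot: "R b c a" if "R a b c" "a \<in> V" "b \<in> V" "c \<in> V" for a b c
    using R that unfolding cyclic_order_on_def by blast
  have asym: "\<not> R c b a" if "R a b c" "a \<in> V" "b \<in> V" "c \<in> V" for a b c
    using R that unfolding cyclic_order_on_def by blast
  have tr: "R a b d" if "R a b c" "R a c d" "a \<in> V" "b \<in> V" "c \<in> V" "d \<in> V" for a b c d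
    using R that unfolding cyclic_order_on_def by blast
  have tot: "R a b c \<or> R c b a" if "a \<in> V" "b \<in> V" "c \<in> V" "a \<noteq> b" "b \<noteq> c" "a \<noteq> c" for a b c
    using R that unfolding cyclic_order_on_def by blast
  have dist: "a \<noteq> b \<and> b \<noteq> c \<and> a \<noteq> c" if "R a b c" "a \<in> V" "b \<in> V" "c \<in> V" for a b c
    using asym rot that by metis
  \<comment> \<open>The circle is cut just before \<open>v\<close>, which becomes the least
    element.\<close>
  define lt where "lt a b \<longleftrightarrow> a = v \<and> b \<noteq> v \<or> R v a b" for a b
  have lt_irrefl: "\<not> lt a a" if "a \<in> V" for a
    using dist v that unfolding lt_def by blast
  have lt_trans: "lt a c" if "lt a b" "lt b c" "a \<in> V" "b \<in> V" "c \<in> V" for a b c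
    using that tr dist v unfolding lt_def by metis
  have lt_total: "lt a b \<or> lt b a" if "a \<in> V" "b \<in> V" "a \<noteq> b" for a b
    using that tot[of v a b] rot v unfolding lt_def by metis
  define f where "f a = card {b \<in> V. lt b a}" for a
  have mono: "f a < f b" if "lt a b" "a \<in> V" "b \<in> V" for a b
    unfolding f_def
  proof (rule psubset_card_mono)
    show "finite {c \<in> V. lt c b}" using assms(1) by simp
    show "{c \<in> V. lt c a} \<subset> {c \<in> V. lt c b}"
      using that lt_trans lt_irrefl by blast
  qed
  have f_less: "f a < f b \<longleftrightarrow> lt a b" if "a \<in> V" "b \<in> V" for a b
    using mono that lt_total by (metis less_asym less_irrefl)
  have inj: "inj_on f V"
    using mono lt_total by (metis inj_onI less_irrefl)
  have "f a < card V" if "a \<in> V" for a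
    unfolding f_def
    by (rule psubset_card_mono) (use assms(1) that lt_irrefl in auto)
  then have "f ` V = {..<card V}"
    using card_image[OF inj] by (intro card_subset_eq) auto
  with inj have bij: "bij_betw f V {..<card V}"
    by (simp add: bij_betw_def)
  have lt_R: "R a b c" if "lt a b" "lt b c" "a \<in> V" "b \<in> V" "c \<in> V" for a b c
  proof (cases "a = v")
    case True
    then show ?thesis using that dist v unfolding lt_def by metis
  next
    case False
    then have "R v a b" "R v b c" using that dist v unfolding lt_def by metis+
    \<comment> \<open>Transitivity needs a common first argument, so both triples are rotated to
      start at \<open>b\<close>.\<close>
    then have "R b v a" "R b c v" using rot that v by blast+
    then have "R b c a" using tr that v by blast
    then show ?thesis using rot that by blast
  qed
  have ccw_R: "R a b c" if "ccw (f a) (f b) (f c)" "a \<in> V" "b \<in> V" "c \<in> V" for a b c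
    using that f_less lt_R rot unfolding ccw_def by metis
  have "R a b c \<longleftrightarrow> ccw (f a) (f b) (f c)" if V: "a \<in> V" "b \<in> V" "c \<in> V" for a b c
  proof
    assume abc: "R a b c"
    then have "a \<noteq> b" "b \<noteq> c" "a \<noteq> c" using dist V by blast+
    then have "f a \<noteq> f b" "f b \<noteq> f c" "f a \<noteq> f c"
      using inj V by (auto dest: inj_onD)
    \<comment> \<open>Three distinct positions are oriented one way or the other; the reverse
      orientation would give \<open>R c b a\<close>, against asymmetry.\<close>
    then have "ccw (f a) (f b) (f c) \<or> ccw (f c) (f b) (f a)"
      unfolding ccw_def by linarith
    with ccw_R[of c b a] asym[OF abc] V show "ccw (f a) (f b) (f c)" by blast
  qed (use ccw_R V in blast)
  with bij show ?thesis using that by blast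
qed

section \<open>Containment, relabelling and the minimum\<close>

lemma containsI:
  assumes "\<phi> ` verts C \<subseteq> verts H" "inj_on \<phi> (verts C)"
    "\<And>a b c. a \<in> verts C \<Longrightarrow> b \<in> verts C \<Longrightarrow> c \<in> verts C \<Longrightarrow> cyc C a b c \<Longrightarrow>
       cyc H (\<phi> a) (\<phi> b) (\<phi> c)"
    "\<And>u v. {u, v} \<in> edges C \<Longrightarrow> {\<phi> u, \<phi> v} \<in> edges H"
  shows "contains H C"
  using assms unfolding contains_def by blast

lemma containsE:
  assumes "contains H C"
  obtains \<phi> where "\<phi> ` verts C \<subseteq> verts H" "inj_on \<phi> (verts C)"
    "\<And>a b c. a \<in> verts C \<Longrightarrow> b \<in> verts C \<Longrightarrow> c \<in> verts C \<Longrightarrow> cyc C a b c \<Longrightarrow>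
       cyc H (\<phi> a) (\<phi> b) (\<phi> c)"
    "\<And>u v. {u, v} \<in> edges C \<Longrightarrow> {\<phi> u, \<phi> v} \<in> edges H"
  using assms unfolding contains_def by blast

lemma contains_trans:
  assumes "contains G H" "contains H C"
  shows "contains G C"
proof -
  obtain g where g: "g ` verts H \<subseteq> verts G" "inj_on g (verts H)"
    "\<And>a b c. a \<in> verts H \<Longrightarrow> b \<in> verts H \<Longrightarrow> c \<in> verts H \<Longrightarrow> cyc H a b c \<Longrightarrow>
       cyc G (g a) (g b) (g c)"
    "\<And>u v. {u, v} \<in> edges H \<Longrightarrow> {g u, g v} \<in> edges G"
    using assms(1) by (rule containsE) blast
  obtain h where h: "h ` verts C \<subseteq> verts H" "inj_on h (verts C)"
    "\<And>a b c. a \<in> verts C \<Longrightarrow> b \<in> verts C \<Longrightarrow> c \<in> verts C \<Longrightarrow> cyc C a b c \<Longrightarrow>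
       cyc H (h a) (h b) (h c)"
    "\<And>u v. {u, v} \<in> edges C \<Longrightarrow> {h u, h v} \<in> edges H"
    using assms(2) by (rule containsE) blast
  show ?thesis
  proof (rule containsI[of "g \<circ> h"])
    show "inj_on (g \<circ> h) (verts C)"
      using g(2) h(1,2) by (meson comp_inj_on inj_on_subset)
  qed (use g h in \<open>auto simp: image_subset_iff\<close>)
qed

text \<open>An isomorphism makes \<open>G\<close> and \<open>H\<close> contain each other, so
  transitivity of containment gives both directions.\<close>

lemma contains_transfer:
  assumes bij: "bij_betw f (verts H) (verts G)"
    and cyc: "\<And>a b c. a \<in> verts H \<Longrightarrow> b \<in> verts H \<Longrightarrow> c \<in> verts H \<Longrightarrow>
      cyc H a b c \<longleftrightarrow> cyc G (f a) (f b) (f c)"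
    and H: "edges H \<subseteq> pairs (verts H)"
    and G: "edges G = (`) f ` edges H"
  shows "contains G C \<longleftrightarrow> contains H C"
proof
  have f: "f a \<in> verts G" if "a \<in> verts H" for a
    using bij that by (rule bij_betw_apply)
  have "contains G H"
  proof (rule containsI[of f])
    show "{f u, f v} \<in> edges G" if "{u, v} \<in> edges H" for u v
      using imageI[OF that, of "(`) f"] G by simp
  qed (use bij f cyc in \<open>auto simp: bij_betw_def\<close>)
  then show "contains G C" if "contains H C"
    using that contains_trans by blast
  define g where "g = inv_into (verts H) f"
  have bij': "bij_betw g (verts G) (verts H)"
    unfolding g_def using bij by (rule bij_betw_inv_into)
  have g: "g a \<in> verts H" "f (g a) = a" if "a \<in> verts G" for a
    using bij_betw_apply[OF bij' that] bij_betw_inv_into_right[OF bij that] g_def by auto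
  have gf: "g (f a) = a" if "a \<in> verts H" for a
    using bij_betw_inv_into_left[OF bij that] g_def by simp
  have "contains H G"
  proof (rule containsI[of g])
    show "{g u, g v} \<in> edges H" if uv: "{u, v} \<in> edges G" for u v
    proof -
      obtain e where e: "e \<in> edges H" "{u, v} = f ` e" using uv G by auto
      \<comment> \<open>Edges of \<open>H\<close> lie inside its vertex set, where \<open>g\<close>
        undoes \<open>f\<close>.\<close>
      have "e \<subseteq> verts H" using e(1) H by (auto elim: pairsE)
      then have "g ` f ` e = e" using gf by (force simp: image_iff subset_iff)
      then have "{g u, g v} = e" by (simp flip: e(2))
      with e(1) show ?thesis by simp
    qed
  qed (use bij' g cyc in \<open>auto simp: bij_betw_def\<close>)
  then show "contains H C" if "contains G C"
    using that contains_trans by blast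
qed

text \<open>The ranking of the vertices is an isomorphism for \<open>H\<close> and for each
  \<open>add_edge H a b\<close> alike, so both halves of saturation transfer.\<close>

lemma saturating_circ_graph:
  assumes H: "cyclically_ordered_graph H" and sat: "saturates H C"
  obtains E where "E \<subseteq> pairs {..<card (verts H)}" "saturates (circ_graph (card (verts H)) E) C"
    "card E = card (edges H)"
proof -
  let ?n = "card (verts H)"
  have H': "finite (verts H)" "cyclic_order_on (verts H) (cyc H)" "edges H \<subseteq> pairs (verts H)"
    using H by (simp_all add: cyclically_ordered_graph_iff)
  obtain f where bij: "bij_betw f (verts H) {..<?n}"
    and cyc: "\<And>a b c. a \<in> verts H \<Longrightarrow> b \<in> verts H \<Longrightarrow> c \<in> verts H \<Longrightarrow>
      cyc H a b c \<longleftrightarrow> ccw (f a) (f b) (f c)"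
    using cyclic_order_rank[OF H'(1,2)] by blast
  have inj: "inj_on f (verts H)" and img: "f ` verts H = {..<?n}"
    using bij by (simp_all add: bij_betw_def)
  define E where "E = (`) f ` edges H"
  have inj_edges: "inj_on ((`) f) (Pow (verts H))"
    using inj by (rule inj_on_image_Pow)
  have sub: "pairs (verts H) \<subseteq> Pow (verts H)" by (auto elim: pairsE)
  have "card E = card (edges H)"
    unfolding E_def using inj_edges H'(3) sub by (meson card_image inj_on_subset subset_trans)
  moreover have "E \<subseteq> pairs {..<?n}"
  proof
    fix e assume "e \<in> E"
    then obtain u v where "e = {f u, f v}" "u \<in> verts H" "v \<in> verts H" "u \<noteq> v"
      using H'(3) unfolding E_def by (force elim: pairsE)
    then show "e \<in> pairs {..<?n}"
      using inj img by (auto dest: inj_onD)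
  qed
  moreover have "saturates (circ_graph ?n E) C"
    unfolding saturates_def
  proof (intro conjI ballI impI)
    have "contains (circ_graph ?n E) C \<longleftrightarrow> contains H C"
      by (rule contains_transfer[of f]) (use bij cyc H' in \<open>auto simp: E_def\<close>)
    then show "avoids (circ_graph ?n E) C" using sat by (simp add: saturates_def)
  next
    fix x y assume "x \<in> verts (circ_graph ?n E)" "y \<in> verts (circ_graph ?n E)"
      and "x \<noteq> y" and E: "{x, y} \<notin> edges (circ_graph ?n E)"
    then obtain a b where ab: "a \<in> verts H" "b \<in> verts H" "x = f a" "y = f b" "a \<noteq> b"
      using img by (metis circ_graph_simps(1) image_iff)
    have "{a, b} \<notin> edges H"
      using E ab unfolding E_def by (auto simp: image_iff)
    then have "contains (add_edge H a b) C"
      using ab sat unfolding saturates_def by blast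
    moreover have "contains (circ_graph ?n (insert {x, y} E)) C \<longleftrightarrow> contains (add_edge H a b) C"
      by (rule contains_transfer[of f]) (use bij cyc H' ab in \<open>auto simp: E_def\<close>)
    ultimately show "contains (add_edge (circ_graph ?n E) x y) C" by simp
  qed
  ultimately show ?thesis using that by blast
qed

lemma cyc_sat_le:
  assumes "E \<subseteq> pairs {..<n}" "saturates (circ_graph n E) C"
  shows "cyc_sat n C \<le> card E"
  unfolding cyc_sat_def
proof (rule Least_le, intro exI conjI)
  show "cyclically_ordered_graph (circ_graph n E)"
    using assms(1) by (simp add: cyclically_ordered_graph_iff cyclic_order_on_ccw)
qed (use assms in auto)

text \<open>\<open>LEAST\<close> is informative only when some saturating graph exists; the given
  \<open>E\<close> is that witness. The minimiser is then put in normal form.\<close>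

lemma cyc_sat_attained:
  assumes "E \<subseteq> pairs {..<n}" "saturates (circ_graph n E) C"
  obtains E' where "E' \<subseteq> pairs {..<n}" "saturates (circ_graph n E') C" "card E' = cyc_sat n C"
proof -
  let ?P = "\<lambda>m. \<exists>H :: nat cyc_graph. cyclically_ordered_graph H \<and> card (verts H) = n \<and>
        saturates H C \<and> card (edges H) = m"
  have "cyclically_ordered_graph (circ_graph n E)"
    using assms(1) by (simp add: cyclically_ordered_graph_iff cyclic_order_on_ccw)
  then have "?P (card E)" using assms(2) by (intro exI[of _ "circ_graph n E"]) auto
  then have "?P (cyc_sat n C)" unfolding cyc_sat_def by (rule LeastI)
  then show ?thesis using saturating_circ_graph that by metis
qed


section \<open>Inserting isolated vertices\<close>

text \<open>The renaming of the old vertices when a new one is inserted at position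
  \<open>z\<close>, which is the only value missed.\<close>

definition skip :: "nat \<Rightarrow> nat \<Rightarrow> nat" where
  "skip z i = (if i < z then i else Suc i)"

definition unskip :: "nat \<Rightarrow> nat \<Rightarrow> nat" where
  "unskip z i = (if i < z then i else i - 1)"

lemma unskip_skip [simp]: "unskip z (skip z i) = i"
  by (auto simp: skip_def unskip_def)

lemma skip_unskip: "i \<noteq> z \<Longrightarrow> skip z (unskip z i) = i"
  by (auto simp: skip_def unskip_def)

lemma inj_skip: "inj (skip z)"
  by (metis injI unskip_skip)

lemma strict_mono_unskip: "strict_mono_on (- {z}) (unskip z)"
  by (auto simp: strict_mono_on_def unskip_def)

lemma strict_mono_skip: "strict_mono (skip z)"
  by (auto simp: strict_mono_def skip_def)

lemma insert_isolated:
  assumes E: "E \<subseteq> pairs {..<n}" and sat: "saturates (circ_graph n E) C"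
    and C: "finite (verts C)" "edges C \<subseteq> pairs (verts C)"
    and k: "card (verts C) \<le> k" "2 \<le> k"
    and run: "a + k \<le> n" "\<Union>E \<inter> {a..<a + k} = {}"
  obtains E' where "E' \<subseteq> pairs {..<Suc n}" "saturates (circ_graph (Suc n) E') C"
    "card E' = card E" "\<Union>E' \<inter> {a..<a + k} = {}"
proof -
  define E' where "E' = (`) (skip a) ` E"
  txt \<open>As the run carries no edges, it does not matter which of its vertices is the new one.\<close>
  have E'_eq: "E' = (`) (skip z) ` E" if "z \<in> {a..a + k}" for z
    unfolding E'_def
  proof (intro image_cong refl)
    fix e i assume "e \<in> E" "i \<in> e"
    then have "i < a \<or> a + k \<le> i" using run by force
    then show "skip a i = skip z i" using that by (auto simp: skip_def)
  qed
  have skip_mem: "{skip z x, skip z y} \<in> E' \<longleftrightarrow> {x, y} \<in> E" if "z \<in> {a..a + k}" for z x y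
  proof -
    have "inj ((`) (skip z))" by (rule injI) (simp add: inj_image_eq_iff inj_skip)
    from inj_image_mem_iff[OF this, of "{x, y}" E] show ?thesis by (simp add: E'_eq[OF that])
  qed
  have "E' \<subseteq> pairs {..<Suc n}"
  proof
    fix e assume "e \<in> E'"
    then obtain d where "d \<in> E" "e = skip a ` d" unfolding E'_def by blast
    moreover from this obtain u v where "d = {u, v}" "u < n" "v < n" "u \<noteq> v"
      using E by (metis lessThan_iff pairsE subsetD)
    moreover have "skip a i < Suc n" if "i < n" for i using that by (simp add: skip_def)
    ultimately show "e \<in> pairs {..<Suc n}" by (simp add: inj_eq[OF inj_skip])
  qed
  moreover have "card E' = card E"
    unfolding E'_def by (intro card_image inj_onI) (simp add: inj_image_eq_iff inj_skip)
  moreover have "\<Union>E' \<inter> {a..<a + k} = {}"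
  proof -
    have "skip a i \<notin> {a..<a + k}" if "i \<in> \<Union>E" for i
    proof -
      have "i \<notin> {a..<a + k}" using that run(2) by blast
      then show ?thesis by (auto simp: skip_def)
    qed
    then show ?thesis unfolding E'_def by blast
  qed
  moreover have "saturates (circ_graph (Suc n) E') C"
    unfolding saturates_def
  proof (intro conjI ballI impI notI)
    assume "contains (circ_graph (Suc n) E') C"
    then obtain \<phi> where \<phi>: "\<phi> ` verts C \<subseteq> {..<Suc n}" "inj_on \<phi> (verts C)"
      "\<And>a b c. a \<in> verts C \<Longrightarrow> b \<in> verts C \<Longrightarrow> c \<in> verts C \<Longrightarrow> cyc C a b c \<Longrightarrow>
         ccw (\<phi> a) (\<phi> b) (\<phi> c)"
      "\<And>u v. {u, v} \<in> edges C \<Longrightarrow> {\<phi> u, \<phi> v} \<in> E'"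
      by (elim containsE, unfold circ_graph_simps) blast
    \<comment> \<open>At most \<open>k\<close> of the \<open>k + 1\<close> positions in the run are
      hit by the copy of \<open>C\<close>.\<close>
    have "card (\<phi> ` verts C) < card {a..a + k}"
      using card_image_le[OF C(1), of \<phi>] k by simp
    then obtain z where z: "z \<in> {a..a + k}" "z \<notin> \<phi> ` verts C"
      by (metis C(1) card_mono finite_imageI linorder_not_less subsetI)
    have mem: "\<phi> v \<in> - {z}" if "v \<in> verts C" for v using z that by auto
    have "contains (circ_graph n E) C"
    proof (rule containsI[of "unskip z \<circ> \<phi>"])
      show "(unskip z \<circ> \<phi>) ` verts C \<subseteq> verts (circ_graph n E)"
        using \<phi>(1) mem z(1) run(1) by (force simp: unskip_def)
      show "inj_on (unskip z \<circ> \<phi>) (verts C)"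
        using \<phi>(2) mem by (intro comp_inj_on inj_on_subset[OF strict_mono_on_imp_inj_on[OF strict_mono_unskip]]) auto
      show "cyc (circ_graph n E) ((unskip z \<circ> \<phi>) a) ((unskip z \<circ> \<phi>) b) ((unskip z \<circ> \<phi>) c)"
        if "a \<in> verts C" "b \<in> verts C" "c \<in> verts C" "cyc C a b c" for a b c
        using ccw_mono[OF strict_mono_unskip] mem \<phi>(3) that by simp
      show "{(unskip z \<circ> \<phi>) u, (unskip z \<circ> \<phi>) v} \<in> edges (circ_graph n E)"
        if "{u, v} \<in> edges C" for u v
      proof -
        have "u \<in> verts C" "v \<in> verts C" using that C(2) by auto
        then have "skip z (unskip z (\<phi> u)) = \<phi> u" "skip z (unskip z (\<phi> v)) = \<phi> v"
          using mem by (auto intro: skip_unskip)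
        then show ?thesis
          using \<phi>(4)[OF that] skip_mem[OF z(1), of "unskip z (\<phi> u)" "unskip z (\<phi> v)"] by simp
      qed
    qed
    then show False using sat by (simp add: saturates_def)
  next
    fix x y assume xy: "x \<in> verts (circ_graph (Suc n) E')" "y \<in> verts (circ_graph (Suc n) E')"
      "x \<noteq> y" "{x, y} \<notin> edges (circ_graph (Suc n) E')"
    \<comment> \<open>Here \<open>2 \<le> k\<close> enters: the run has at least three positions,
      and \<open>x\<close>, \<open>y\<close> occupy at most two.\<close>
    obtain z where z: "z \<in> {a..a + k}" "z \<noteq> x" "z \<noteq> y"
    proof -
      have "card {x, y} < card {a..a + k}" using k(2) by (simp add: card_insert_if)
      then have "\<not> {a..a + k} \<subseteq> {x, y}" by (metis card_mono finite.intros linorder_not_less)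
      then show ?thesis using that by blast
    qed
    define x' y' where "x' = unskip z x" and "y' = unskip z y"
    have x': "skip z x' = x" "skip z y' = y"
      unfolding x'_def y'_def using z by (auto intro: skip_unskip)
    have "x' < n" "y' < n"
      using xy z run(1) unfolding x'_def y'_def by (auto simp: unskip_def)
    moreover have "x' \<noteq> y'" using x' xy(3) by auto
    moreover have "{x', y'} \<notin> E" using skip_mem[OF z(1), of x' y'] xy(4) x' by simp
    ultimately have "contains (circ_graph n (insert {x', y'} E)) C"
      using sat unfolding saturates_def by simp
    \<comment> \<open>The copy of \<open>C\<close> created by the old non-edge is lifted along
      \<open>skip z\<close>, which sends that non-edge to \<open>{x, y}\<close>.\<close>
    moreover have "contains (circ_graph (Suc n) (insert {x, y} E')) (circ_graph n (insert {x', y'} E))"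
    proof (rule containsI[of "skip z"])
      show "skip z ` verts (circ_graph n (insert {x', y'} E))
          \<subseteq> verts (circ_graph (Suc n) (insert {x, y} E'))"
        by (auto simp: skip_def)
      show "cyc (circ_graph (Suc n) (insert {x, y} E')) (skip z a) (skip z b) (skip z c)"
        if "cyc (circ_graph n (insert {x', y'} E)) a b c" for a b c
        using ccw_mono[OF strict_mono_skip] that by simp
      show "{skip z u, skip z v} \<in> edges (circ_graph (Suc n) (insert {x, y} E'))"
        if "{u, v} \<in> edges (circ_graph n (insert {x', y'} E))" for u v
        using that skip_mem[OF z(1), of u v] x' by (auto simp: doubleton_eq_iff)
    qed (use inj_skip in \<open>auto intro: inj_on_subset\<close>)
    ultimately show "contains (add_edge (circ_graph (Suc n) E') x y) C"
      using contains_trans by simp blast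
  qed
  ultimately show ?thesis using that by blast
qed

text \<open>Vertices are inserted one at a time; the induction carries the isolated run along, and
  the number of edges never changes.\<close>

lemma cyc_sat_bounded:
  assumes E: "E \<subseteq> pairs {..<n}" "saturates (circ_graph n E) C"
    and C: "finite (verts C)" "edges C \<subseteq> pairs (verts C)"
    and k: "card (verts C) \<le> k" "2 \<le> k"
    and run: "a + k \<le> n" "\<Union>E \<inter> {a..<a + k} = {}"
    and "n \<le> m"
  shows "cyc_sat m C \<le> card E"
proof -
  have "\<exists>E'. E' \<subseteq> pairs {..<m} \<and> saturates (circ_graph m E') C \<and> card E' = card E \<and>
    \<Union>E' \<inter> {a..<a + k} = {}"
    using \<open>n \<le> m\<close>
  proof (induction rule: dec_induct)
    case base
    then show ?case using E run by blast
  next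
    case (step m)
    then obtain E' where "E' \<subseteq> pairs {..<m}" "saturates (circ_graph m E') C" "card E' = card E"
      "\<Union>E' \<inter> {a..<a + k} = {}" by blast
    moreover have "a + k \<le> m" using run(1) step by simp
    ultimately show ?case using insert_isolated[OF _ _ C k] by metis
  qed
  then show ?thesis using cyc_sat_le by metis
qed

section \<open>The linear lower bound\<close>

lemma card_edges_ge:
  fixes E :: "nat set set"
  assumes E: "E \<subseteq> pairs {..<n}" and "0 < k"
    and run: "\<And>a. a + k \<le> n \<Longrightarrow> \<Union>E \<inter> {a..<a + k} \<noteq> {}"
  shows "n \<le> 2 * k * card E + k"
proof -
  have "finite E" using E finite_pairs finite_subset by blast
  \<comment> \<open>The circle is split into \<open>n div k\<close> disjoint full blocks, labelled
    by \<open>v div k\<close>; each contains an endpoint of an edge.\<close>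
  have "\<exists>v. v \<in> \<Union>E \<and> v div k = j" if "j < n div k" for j
  proof -
    have "Suc j * k \<le> n div k * k" using that by (intro mult_le_mono1) simp
    also have "\<dots> \<le> n" by simp
    finally have "\<Union>E \<inter> {j * k..<j * k + k} \<noteq> {}"
      by (intro run) (simp add: add.commute)
    then obtain v where v: "v \<in> \<Union>E" "v \<in> {j * k..<j * k + k}" by blast
    from v(2) have "v div k = j" by (intro div_nat_eqI) (auto simp: ac_simps)
    with v(1) show ?thesis by blast
  qed
  then have "{..<n div k} \<subseteq> (\<lambda>v. v div k) ` \<Union>E" by blast
  moreover have "finite (\<Union>E)"
  proof (rule finite_subset)
    show "\<Union>E \<subseteq> {..<n}" using E by (fastforce elim: pairsE)
  qed simp
  ultimately have "n div k \<le> card (\<Union>E)"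
    using surj_card_le by fastforce
  \<comment> \<open>Each edge has two endpoints and hence accounts for at most two blocks.\<close>
  also have "\<dots> \<le> (\<Sum>e\<in>E. card e)"
    by (rule card_Union_le_sum_card)
  also have "\<dots> \<le> (\<Sum>e\<in>E. 2)"
  proof (rule sum_mono)
    fix e assume "e \<in> E"
    then obtain u v where "e = {u, v}" using E by (meson pairsE subsetD)
    then show "card e \<le> 2" by (simp add: card_insert_if)
  qed
  finally have "n div k \<le> 2 * card E" by simp
  \<comment> \<open>The incomplete last block costs the additive \<open>k\<close>.\<close>
  moreover have "n mod k \<le> k" using \<open>0 < k\<close> by (simp add: less_imp_le)
  ultimately have "k * (n div k) + n mod k \<le> k * (2 * card E) + k"
    by (intro add_mono mult_le_mono2)
  then show ?thesis by (simp add: ac_simps)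
qed


section \<open>The linear upper bound\<close>

text \<open>
  The layout \<open>f\<close> may leave gaps, so that an embedding of \<open>C\<close> into a \<open>circ_graph\<close> can itself serve as \<open>f\<close>.
\<close>

definition arc_cover :: "'a cyc_graph \<Rightarrow> nat \<Rightarrow> ('a \<Rightarrow> nat) \<Rightarrow> bool" where
  "arc_cover C t f \<longleftrightarrow> inj_on f (verts C) \<and>
     (\<forall>a\<in>verts C. \<forall>b\<in>verts C. \<forall>c\<in>verts C. cyc C a b c \<longrightarrow> ccw (f a) (f b) (f c)) \<and>
     (\<forall>u v. {u, v} \<in> edges C \<longrightarrow> f u < t \<or> f v < t)"

text \<open>The whole circle is a covering arc. This makes the shortest one, chosen in
  \<open>saturating_linear\<close>, well defined.\<close>

lemma ex_arc_cover:
  assumes "cyclically_ordered_graph C"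
  shows "\<exists>t f. arc_cover C t f"
proof -
  have C: "finite (verts C)" "cyclic_order_on (verts C) (cyc C)" "edges C \<subseteq> pairs (verts C)"
    using assms by (simp_all add: cyclically_ordered_graph_iff)
  obtain f where f: "bij_betw f (verts C) {..<card (verts C)}"
    "\<And>a b c. a \<in> verts C \<Longrightarrow> b \<in> verts C \<Longrightarrow> c \<in> verts C \<Longrightarrow>
      cyc C a b c \<longleftrightarrow> ccw (f a) (f b) (f c)"
    using cyclic_order_rank[OF C(1,2)] by blast
  have "f u < card (verts C)" if "{u, v} \<in> edges C" for u v
  proof -
    have "u \<in> verts C" using that C(3) by auto
    then show ?thesis using bij_betw_apply[OF f(1)] by blast
  qed
  then have "arc_cover C (card (verts C)) f"
    using f unfolding arc_cover_def bij_betw_def by blast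
  then show ?thesis by blast
qed

text \<open>There are only finitely many edge sets on \<open>n\<close> vertices, so some
  \<open>C\<close>-avoiding one above the given set is maximal, and maximality is
  saturation.\<close>

lemma extend_to_saturating:
  assumes "E\<^sub>0 \<subseteq> pairs {..<n}" "avoids (circ_graph n E\<^sub>0) C"
  obtains E where "E\<^sub>0 \<subseteq> E" "E \<subseteq> pairs {..<n}" "saturates (circ_graph n E) C"
proof -
  define \<E> where "\<E> = {E. E \<subseteq> pairs {..<n} \<and> avoids (circ_graph n E) C}"
  have "finite \<E>" unfolding \<E>_def
    by (rule finite_subset[of _ "Pow (pairs {..<n})"]) (auto simp: finite_pairs)
  moreover have "E\<^sub>0 \<in> \<E>" using assms by (simp add: \<E>_def)
  ultimately obtain E where E: "E \<in> \<E>" "E\<^sub>0 \<subseteq> E" and max: "\<forall>F\<in>\<E>. E \<subseteq> F \<longrightarrow> E = F"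
    using finite_has_maximal2[of \<E> E\<^sub>0] by blast
  have "saturates (circ_graph n E) C"
    unfolding saturates_def
  proof (intro conjI ballI impI)
    show "avoids (circ_graph n E) C" using E by (simp add: \<E>_def)
    fix x y assume "x \<in> verts (circ_graph n E)" "y \<in> verts (circ_graph n E)"
      "x \<noteq> y" "{x, y} \<notin> edges (circ_graph n E)"
    then show "contains (add_edge (circ_graph n E) x y) C"
      using E max[rule_format, of "insert {x, y} E"] by (auto simp: \<E>_def)
  qed
  then show ?thesis using that E by (simp add: \<E>_def)
qed

lemma ex_strict_mono_into:
  fixes N :: "nat set"
  assumes "finite N" "K \<le> card N"
  obtains g where "strict_mono_on {..<K} g" "g ` {..<K} \<subseteq> N"
proof
  let ?xs = "sorted_list_of_set N"
  show "strict_mono_on {..<K} ((!) ?xs)"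
  proof (rule strict_mono_onI)
    fix i j assume "i \<in> {..<K}" "j \<in> {..<K}" "i < j"
    then show "?xs ! i < ?xs ! j"
      using assms by (intro sorted_wrt_nth_less[OF strict_sorted_list_of_set]) auto
  qed
  show "(!) ?xs ` {..<K} \<subseteq> N"
    using assms nth_mem[of _ ?xs] by fastforce
qed

text \<open>With too many right neighbours of \<open>x\<close>, a copy of \<open>C\<close> appears:
  arc positions below \<open>s\<close> go to the hubs \<open>0, ..., s - 1\<close>, the last arc
  position \<open>s\<close> to \<open>x\<close>, and all later positions to right neighbours of
  \<open>x\<close>.\<close>

lemma right_degree_bound:
  assumes f: "arc_cover C (Suc s) f" "f ` verts C \<subseteq> {..<K}"
    and C: "edges C \<subseteq> pairs (verts C)"
    and E: "E \<subseteq> pairs {..<n}" "{e \<in> pairs {..<n}. \<exists>i\<in>e. i < s} \<subseteq> E"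
    and avoid: "avoids (circ_graph n E) C"
    and x: "s \<le> x" "x < n"
  shows "card {y. x < y \<and> {x, y} \<in> E} \<le> K"
proof (rule ccontr)
  let ?N = "{y. x < y \<and> {x, y} \<in> E}"
  assume "\<not> card ?N \<le> K"
  moreover have N: "?N \<subseteq> {..<n}" using E(1) by auto
  ultimately obtain h where h: "strict_mono_on {..<K} h" "h ` {..<K} \<subseteq> ?N"
    using ex_strict_mono_into[of ?N K] finite_subset[OF N] by (auto simp: not_le less_imp_le)
  \<comment> \<open>\<open>h\<close> is indexed by the position itself rather than from zero, so
    \<open>K\<close> neighbours are selected although only those beyond index \<open>s\<close>
    serve.\<close>
  define g where "g i = (if i < s then i else if i = s then x else h i)" for i
  have hN: "x < h i" "{x, h i} \<in> E" "h i < n" if "i < K" for i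
    using h(2) N that by blast+
  have g_mono: "strict_mono_on {..<K} g"
  proof (rule strict_mono_onI)
    fix i j assume ij: "i \<in> {..<K}" "j \<in> {..<K}" "i < j"
    then show "g i < g j"
      using strict_mono_onD[OF h(1) ij] hN(1)[of j] x by (auto simp: g_def)
  qed
  have g_less: "g i < n" if "i < K" for i
    using hN(3)[OF that] x by (simp add: g_def)
  have edge: "{g i, g j} \<in> E" if "i < Suc s" "i \<noteq> j" "i < K" "j < K" for i j
  proof -
    have "g i \<noteq> g j"
      using strict_mono_on_imp_inj_on[OF g_mono] that by (auto dest: inj_onD)
    then have pair: "{g i, g j} \<in> pairs {..<n}" using g_less that by simp
    show ?thesis
    \<comment> \<open>Either a hub is involved, and hubs are joined to everything, or the edge runs
      from \<open>x\<close> to one of its chosen neighbours.\<close>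
    proof (cases "i < s \<or> j < s")
      case True
      then have "\<exists>l\<in>{g i, g j}. l < s" by (auto simp: g_def)
      with pair E(2) show ?thesis by blast
    next
      case False
      then have "i = s" "s < j" using that by auto
      then show ?thesis using hN(2)[of j] that by (simp add: g_def)
    qed
  qed
  have fK: "f v \<in> {..<K}" if "v \<in> verts C" for v using f(2) that by blast
  have "contains (circ_graph n E) C"
  proof (rule containsI[of "g \<circ> f"])
    show "(g \<circ> f) ` verts C \<subseteq> verts (circ_graph n E)"
      using g_less fK by auto
    show "inj_on (g \<circ> f) (verts C)"
      using f strict_mono_on_imp_inj_on[OF g_mono] unfolding arc_cover_def
      by (meson comp_inj_on inj_on_subset)
    show "cyc (circ_graph n E) ((g \<circ> f) a) ((g \<circ> f) b) ((g \<circ> f) c)"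
      if "a \<in> verts C" "b \<in> verts C" "c \<in> verts C" "cyc C a b c" for a b c
      using ccw_mono[OF g_mono fK fK fK] that f(1) by (simp add: arc_cover_def)
    show "{(g \<circ> f) u, (g \<circ> f) v} \<in> edges (circ_graph n E)" if uv: "{u, v} \<in> edges C" for u v
    proof -
      have V: "u \<in> verts C" "v \<in> verts C" "u \<noteq> v" using subsetD[OF C uv] by simp_all
      have "f u \<noteq> f v" using f(1) V by (auto simp: arc_cover_def dest: inj_onD)
      moreover have "f u < Suc s \<or> f v < Suc s" using f(1) uv by (simp add: arc_cover_def)
      ultimately show ?thesis
        using edge[of "f u" "f v"] edge[of "f v" "f u"] fK V by (auto simp: insert_commute)
    qed
  qed
  with avoid show False by blast
qed

lemma saturating_linear:
  assumes C: "cyclically_ordered_graph C" "edges C \<noteq> {}"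
  obtains K where "\<And>n. \<exists>E. E \<subseteq> pairs {..<n} \<and> saturates (circ_graph n E) C \<and> card E \<le> K * n"
proof -
  have CV: "finite (verts C)" "edges C \<subseteq> pairs (verts C)"
    using C by (simp_all add: cyclically_ordered_graph_iff)
  define t where "t = (LEAST t. \<exists>f. arc_cover C t f)"
  have "\<exists>f. arc_cover C t f"
    unfolding t_def using ex_arc_cover[OF C(1)] by (rule LeastI_ex)
  then obtain f where f: "arc_cover C t f" by blast
  obtain u v where "{u, v} \<in> edges C" using C(2) CV(2) by (metis all_not_in_conv pairsE subsetD)
  \<comment> \<open>An empty arc cannot cover the edge just obtained.\<close>
  then have "t \<noteq> 0" using f by (metis arc_cover_def less_nat_zero_code)
  then obtain s where s: "t = Suc s" by (cases t) auto
  have no_cover: "\<not> arc_cover C s \<phi>" for \<phi>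
    using not_less_Least[of s "\<lambda>t. \<exists>f. arc_cover C t f"] s unfolding t_def by auto
  obtain K where K: "f ` verts C \<subseteq> {..<K}"
    using finite_nat_set_iff_bounded[of "f ` verts C"] CV(1) by auto
  have "\<exists>E. E \<subseteq> pairs {..<n} \<and> saturates (circ_graph n E) C \<and> card E \<le> (s + K) * n" for n
  proof -
    \<comment> \<open>The first \<open>s\<close> vertices are hubs; for \<open>n \<le> s\<close>
      this is the complete graph, and the argument is unchanged.\<close>
    define E\<^sub>0 where "E\<^sub>0 = {e \<in> pairs {..<n}. \<exists>i\<in>e. i < s}"
    have "avoids (circ_graph n E\<^sub>0) C"
    proof
      assume "contains (circ_graph n E\<^sub>0) C"
      then obtain \<phi> where \<phi>: "inj_on \<phi> (verts C)"
        "\<And>a b c. a \<in> verts C \<Longrightarrow> b \<in> verts C \<Longrightarrow> c \<in> verts C \<Longrightarrow> cyc C a b c \<Longrightarrow>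
           ccw (\<phi> a) (\<phi> b) (\<phi> c)"
        "\<And>u v. {u, v} \<in> edges C \<Longrightarrow> {\<phi> u, \<phi> v} \<in> E\<^sub>0"
        by (elim containsE, unfold circ_graph_simps) blast
      have "\<phi> u < s \<or> \<phi> v < s" if "{u, v} \<in> edges C" for u v
        using \<phi>(3)[OF that] by (simp add: E\<^sub>0_def)
      \<comment> \<open>A copy of \<open>C\<close> would be a layout whose covering arc is one
        shorter than the minimum.\<close>
      then have "arc_cover C s \<phi>"
        using \<phi>(1,2) by (simp add: arc_cover_def)
      then show False using no_cover by blast
    qed
    then obtain E where E: "E\<^sub>0 \<subseteq> E" "E \<subseteq> pairs {..<n}" "saturates (circ_graph n E) C"
      using extend_to_saturating[of E\<^sub>0 n C] by (auto simp: E\<^sub>0_def)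
    \<comment> \<open>Every edge is counted at its smaller endpoint.\<close>
    define R where "R x = {y. x < y \<and> {x, y} \<in> E}" for x
    have R_sub: "R x \<subseteq> {..<n}" for x using E(2) by (auto simp: R_def)
    \<comment> \<open>The trivial bound \<open>n\<close> is affordable at the hubs, as there are at
      most \<open>s\<close> of them.\<close>
    have R_le: "card (R x) \<le> (if x < s then n else 0) + K" if "x < n" for x
    proof (cases "x < s")
      case True
      then show ?thesis using card_mono[OF _ R_sub, of x] by simp
    next
      case False
      have "card (R x) \<le> K"
        unfolding R_def
      proof (rule right_degree_bound[OF _ K CV(2) E(2)])
        show "arc_cover C (Suc s) f" using f s by simp
        show "{e \<in> pairs {..<n}. \<exists>i\<in>e. i < s} \<subseteq> E" using E(1) by (simp add: E\<^sub>0_def)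
      qed (use E(3) False that in \<open>auto simp: saturates_def\<close>)
      with False show ?thesis by simp
    qed
    have "E \<subseteq> (\<Union>x<n. (\<lambda>y. {x, y}) ` R x)"
    proof
      fix e assume "e \<in> E"
      then obtain u v where "e = {u, v}" "u < n" "u < v"
        using E(2) by (metis lessThan_iff pairs_nat_ordE subsetD)
      with \<open>e \<in> E\<close> show "e \<in> (\<Union>x<n. (\<lambda>y. {x, y}) ` R x)" by (auto simp: R_def)
    qed
    moreover have finR: "finite (R x)" for x using R_sub finite_subset by blast
    ultimately have "card E \<le> card (\<Union>x<n. (\<lambda>y. {x, y}) ` R x)"
      by (intro card_mono) auto
    also have "\<dots> \<le> (\<Sum>x<n. card ((\<lambda>y. {x, y}) ` R x))"
      by (rule card_UN_le) simp
    also have "\<dots> \<le> (\<Sum>x<n. (if x < s then n else 0) + K)"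
      by (intro sum_mono order_trans[OF card_image_le[OF finR] R_le]) simp
    also have "\<dots> = card {x. x < n \<and> x < s} * n + K * n"
      by (simp add: sum.distrib sum.If_cases Int_def)
    also have "\<dots> \<le> s * n + K * n"
      using card_mono[of "{..<s}" "{x. x < n \<and> x < s}"]
      by (intro add_right_mono mult_le_mono1) auto
    finally have "card E \<le> (s + K) * n" by (simp add: distrib_right)
    with E show ?thesis by blast
  qed
  then show ?thesis using that by blast
qed

section \<open>The dichotomy\<close>

theorem theorem6:
  fixes C :: "'a cyc_graph"
  assumes "cyclically_ordered_graph C"
    and "edges C \<noteq> {}"
  shows "(\<lambda>n. real (cyc_sat n C)) \<in> O(\<lambda>n. 1) \<or> (\<lambda>n. real (cyc_sat n C)) \<in> \<Theta>(\<lambda>n. real n)"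
proof -
  have C: "finite (verts C)" "edges C \<subseteq> pairs (verts C)"
    using assms by (simp_all add: cyclically_ordered_graph_iff)
  define k where "k = card (verts C)"
  obtain u v where "u \<in> verts C" "v \<in> verts C" "u \<noteq> v"
    using assms(2) C(2) by (metis all_not_in_conv pairsE subsetD)
  then have k: "2 \<le> k"
    using card_mono[OF C(1), of "{u, v}"] by (simp add: k_def)
  obtain K where K: "\<And>n. \<exists>E. E \<subseteq> pairs {..<n} \<and> saturates (circ_graph n E) C \<and> card E \<le> K * n"
    using saturating_linear[OF assms] by blast
  have upper: "cyc_sat n C \<le> K * n" for n
    using K[of n] cyc_sat_le order_trans by blast
  show ?thesis
  proof (cases "\<exists>n E a. E \<subseteq> pairs {..<n} \<and> saturates (circ_graph n E) C \<and>
      a + k \<le> n \<and> \<Union>E \<inter> {a..<a + k} = {}")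
    case True
    then obtain n E a where E: "E \<subseteq> pairs {..<n}" "saturates (circ_graph n E) C"
      "a + k \<le> n" "\<Union>E \<inter> {a..<a + k} = {}" by blast
    \<comment> \<open>A single graph with an isolated run bounds the saturation number for all
      larger orders.\<close>
    have "cyc_sat m C \<le> card E" if "n \<le> m" for m
      using cyc_sat_bounded[OF E(1,2) C _ k E(3,4) that] by (simp add: k_def)
    then have "(\<lambda>n. real (cyc_sat n C)) \<in> O(\<lambda>n. 1)"
      by (intro bigoI[of _ "real (card E)"]) (auto simp: eventually_at_top_linorder)
    then show ?thesis ..
  next
    case False
    have lower: "n \<le> 2 * k * cyc_sat n C + k" for n
    proof -
      obtain E where E: "E \<subseteq> pairs {..<n}" "saturates (circ_graph n E) C" "card E = cyc_sat n C"
        using K[of n] cyc_sat_attained by metis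
      have "n \<le> 2 * k * card E + k"
        using False E k by (intro card_edges_ge) auto
      with E(3) show ?thesis by simp
    qed
    have "(\<lambda>n. real (cyc_sat n C)) \<in> O(\<lambda>n. real n)"
    proof (rule bigoI[of _ "real K"])
      show "\<forall>\<^sub>F n in sequentially. norm (real (cyc_sat n C)) \<le> real K * norm (real n)"
        using upper by (intro always_eventually) (simp flip: of_nat_mult)
    qed
    moreover have "(\<lambda>n. real n) \<in> O(\<lambda>n. real (cyc_sat n C))"
    proof (rule bigoI[of _ "real (4 * k)"])
      \<comment> \<open>Once \<open>2 * k \<le> n\<close>, the additive \<open>k\<close> is at most
        half of \<open>n\<close>; absorbing it doubles the constant \<open>2 * k\<close>.\<close>
      have "n \<le> 4 * k * cyc_sat n C" if "2 * k \<le> n" for n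
        using lower[of n] that by linarith
      then show "\<forall>\<^sub>F n in sequentially. norm (real n) \<le> real (4 * k) * norm (real (cyc_sat n C))"
        by (auto simp: eventually_at_top_linorder simp flip: of_nat_mult
            intro!: exI[of _ "2 * k"])
    qed
    ultimately show ?thesis by (simp add: bigtheta_def bigomega_iff_bigo)
  qed
qed

end
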